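(* Let $B\in\mathbb{R}^{E\times M}$, $B\neq 0$, $b\in\mathbb{R}^E$, $\rho\ge 0$, and let $J:\mathbb{R}^M\to\mathbb{R}$ be convex, differentiable and $\delta$-smooth. Assume that the problem $\min_{w\in\mathbb{R}^M} J(w)$ s.t. $Bw=b$ has a unique solution $w^\star$. Put $J_\rho(w)=J(w)+\frac{\rho}{2}\|Bw-b\|^2$ and $\delta_\rho=\delta+\rho\,\sigma_{\max}^2(B)$ (so that $J_\rho$ is $\delta_\rho$-smooth), and assume that $J_\rho$ is $\nu_\rho$-strongly-convex with respect to $w^\star$, i.e. $$(x-w^\star)^{\mathsf T}\big(\nabla J_\rho(x)-\nabla J_\rho(w^\star)\big)\ \ge\ \nu_\rho\|x-w^\star\|^2\qquad\text{for all }x\in\mathbb{R}^M,$$ where $0<\nu_\rho\le\delta_\rho$. Let the step-sizes $\mu_w,\mu_\lambda$ be positive and satisfy $$\mu_w<\frac{1}{\delta_\rho},\qquad \mu_\lambda\le\frac{\nu_\rho}{\sigma_{\max}^2(B)}.$$ Let $w_{-1}\in\mathbb{R}^M$ be arbitrary, let $\lambda_{-1}=0\in\mathbb{R}^E$, and for $i\ge 0$ define $$w_i=w_{i-1}-\mu_w\big(\nabla J_\rho(w_{i-1})+B^{\mathsf T}\lambda_{i-1}\big),\qquad \lambda_i=\lambda_{i-1}+\mu_\lambda(Bw_i-b).$$ Let $\lambda_b^\star$ be the unique optimal dual variable lying in the range space of $B$, and set $\tilde w_i=w_i-w^\star$, $\tilde\lambda_i=\lambda_i-\lambda_b^\star$.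 Then, with $c_w=1-\mu_w\mu_\lambda\sigma_{\max}^2(B)>0$ and some constant $c_\lambda>0$ (independent of $i$), for all $i\ge 0$, $$c_w\|\tilde w_i\|^2+c_\lambda\|\tilde\lambda_i\|^2\ \le\ \gamma\,\big(c_w\|\tilde w_{i-1}\|^2+c_\lambda\|\tilde\lambda_{i-1}\|^2\big),$$ where $$\gamma=\max\big\{1-\mu_w\nu_\rho(1-\mu_w\delta_\rho),\ 1-\mu_w\mu_\lambda\,\underline{\sigma}^2(B)\big\}<1.$$ In particular, $(w_i,\lambda_i)$ converges linearly to $(w^\star,\lambda_b^\star)$.
   Context: Norms are Euclidean. $\sigma_{\max}(B)$ is the largest singular value of $B$ and $\underline{\sigma}(B)$ is its smallest non-zero singular value. A differentiable $f$ is $\delta$-smooth ($\delta>0$) if $\|\nabla f(x)-\nabla f(y)\|\le\delta\|x-y\|$ for all $x,y$. An optimal dual variable is a vector $\lambda^\star\in\mathbb{R}^E$ such that $(w^\star,\lambda^\star)$ satisfies the optimality conditions $\nabla J(w^\star)+B^{\mathsf T}\lambda^\star=0$ and $Bw^\star=b$; under the stated assumptions there is exactly one such vector in the range (column) space of $B$, denoted $\lambda_b^\star$. *)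

theory Defs
  imports "HOL-Analysis.Analysis"
begin

definition grad :: "('a::real_inner \<Rightarrow> real) \<Rightarrow> 'a \<Rightarrow> 'a" where
  "grad f x = (THE g. GDERIV f x :> g)"

definition smooth :: "real \<Rightarrow> ('a::real_inner \<Rightarrow> real) \<Rightarrow> bool" where
  "smooth \<delta> f \<longleftrightarrow> \<delta> > 0 \<and> (\<forall>x. f differentiable (at x)) \<and>
     (\<forall>x y. norm (grad f x - grad f y) \<le> \<delta> * norm (x - y))"

definition strongly_convex_wrt :: "real \<Rightarrow> ('a::real_inner \<Rightarrow> real) \<Rightarrow> 'a \<Rightarrow> bool" where
  "strongly_convex_wrt \<nu> f z \<longleftrightarrow>
     (\<forall>x. (x - z) \<bullet> (grad f x - grad f z) \<ge> \<nu> * (norm (x - z))\<^sup>2)"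

text \<open>Square roots of the eigenvalues of \<open>B\<^sup>T B\<close>. For a wide matrix this set contains \<open>0\<close>
  even if the list of the first \<open>min E M\<close> singular values does not; neither the largest nor the
  smallest non-zero element is affected.\<close>

definition singular_values :: "real ^ 'm ^ 'e \<Rightarrow> real set" where
  "singular_values B =
     {sqrt \<mu> | \<mu>. \<exists>v. v \<noteq> 0 \<and> (transpose B ** B) *v v = \<mu> *\<^sub>R v}"

definition sigma_max :: "real ^ 'm ^ 'e \<Rightarrow> real" where
  "sigma_max B = Max (singular_values B)"

definition sigma_min_nonzero :: "real ^ 'm ^ 'e \<Rightarrow> real" where
  "sigma_min_nonzero B = Min (singular_values B - {0})"

definition augmented_cost ::
  "(real ^ 'm \<Rightarrow> real) \<Rightarrow> real ^ 'm ^ 'e \<Rightarrow> real ^ 'e \<Rightarrow> real \<Rightarrow> real ^ 'm \<Rightarrow> real" where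
  "augmented_cost J B b \<rho> w = J w + \<rho> / 2 * (norm (B *v w - b))\<^sup>2"

definition unique_solution ::
  "(real ^ 'm \<Rightarrow> real) \<Rightarrow> real ^ 'm ^ 'e \<Rightarrow> real ^ 'e \<Rightarrow> real ^ 'm \<Rightarrow> bool" where
  "unique_solution J B b w \<longleftrightarrow>
     is_arg_min J (\<lambda>x. B *v x = b) w \<and>
     (\<forall>v. is_arg_min J (\<lambda>x. B *v x = b) v \<longrightarrow> v = w)"

definition optimal_dual ::
  "(real ^ 'm \<Rightarrow> real) \<Rightarrow> real ^ 'm ^ 'e \<Rightarrow> real ^ 'e \<Rightarrow> real ^ 'm \<Rightarrow> real ^ 'e \<Rightarrow> bool" where
  "optimal_dual J B b w l \<longleftrightarrow> grad J w + transpose B *v l = 0 \<and> B *v w = b"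

definition range_optimal_dual ::
  "(real ^ 'm \<Rightarrow> real) \<Rightarrow> real ^ 'm ^ 'e \<Rightarrow> real ^ 'e \<Rightarrow> real ^ 'm \<Rightarrow> real ^ 'e" where
  "range_optimal_dual J B b w = (THE l. optimal_dual J B b w l \<and> l \<in> range ((*v) B))"

definition converges_linearly :: "(nat \<Rightarrow> 'a::real_normed_vector) \<Rightarrow> 'a \<Rightarrow> bool" where
  "converges_linearly x l \<longleftrightarrow>
     (\<exists>C r. 0 \<le> r \<and> r < 1 \<and> (\<forall>i. norm (x i - l) \<le> C * r ^ i))"

text \<open>Primal-dual gradient recursion started from \<open>\<lambda> = 0\<close>. The sequences are indexed one
  higher than usual, so that \<open>w 0\<close> and \<open>l 0\<close> are the initial values with index \<open>-1\<close>.\<close>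

definition primal_dual_iterates ::
  "(real ^ 'm \<Rightarrow> real) \<Rightarrow> real ^ 'm ^ 'e \<Rightarrow> real ^ 'e \<Rightarrow> real \<Rightarrow> real \<Rightarrow> real \<Rightarrow>
   (nat \<Rightarrow> real ^ 'm) \<Rightarrow> (nat \<Rightarrow> real ^ 'e) \<Rightarrow> bool" where
  "primal_dual_iterates J B b \<rho> \<mu>w \<mu>l w l \<longleftrightarrow>
     l 0 = 0 \<and>
     (\<forall>i. w (Suc i) = w i - \<mu>w *\<^sub>R (grad (augmented_cost J B b \<rho>) (w i) + transpose B *v l i) \<and>
          l (Suc i) = l i + \<mu>l *\<^sub>R (B *v w (Suc i) - b))"

end

theory Submission
  imports Defs
begin

text \<open>The error vectors \<open>x = w - w*\<close>, \<open>y = \<lambda> - \<lambda>*\<close> satisfy \<open>x' = p - \<mu> B\<^sup>T y\<close> and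
  \<open>y' = y + \<kappa> B x'\<close>, where \<open>p\<close> is a gradient step on the augmented cost. Weighting \<open>\<bar>y\<bar>\<^sup>2\<close> by
  \<open>\<mu> / \<kappa>\<close> makes the cross terms cancel, which leaves \<open>\<bar>p\<bar>\<^sup>2\<close> (controlled by co-coercivity of the gradient of
  a smooth convex function and strong convexity with respect to \<open>w*\<close>) and \<open>- \<mu>\<^sup>2 \<bar>B\<^sup>T y\<bar>\<^sup>2\<close>. As the
  dual iterates start at \<open>0\<close>, \<open>y\<close> stays in the range of \<open>B\<close>, where \<open>\<bar>B\<^sup>T y\<bar>\<close> is at least
  the smallest non-zero singular value times \<open>\<bar>y\<bar>\<close>.\<close>

section \<open>Gradients and co-coercivity\<close>

lemma GDERIV_unique:
  assumes "GDERIV f x :> g" and "GDERIV f x :> g'"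
  shows "g = g'"
proof -
  have "(\<lambda>h. h \<bullet> g) = (\<lambda>h. h \<bullet> g')"
    using assms unfolding gderiv_def by (rule has_derivative_unique)
  then show ?thesis
    unfolding fun_eq_iff vector_eq_ldot .
qed

text \<open>Riesz representation: a linear functional \<open>f'\<close> is the inner product with
  \<open>adjoint f' 1\<close>. Together with uniqueness this makes the \<open>THE\<close> in
  \<open>grad\<close> well defined.\<close>

lemma GDERIV_grad:
  fixes f :: "'a::euclidean_space \<Rightarrow> real"
  assumes "f differentiable (at x)"
  shows "GDERIV f x :> grad f x"
proof -
  obtain f' where f': "(f has_derivative f') (at x)"
    using assms by (auto simp: differentiable_def)
  then have "linear f'"
    by (rule has_derivative_linear)
  then have "f' = (\<lambda>h. h \<bullet> adjoint f' 1)"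
    using adjoint_works[of f' _ 1] by (simp add: fun_eq_iff)
  with f' have "GDERIV f x :> adjoint f' 1"
    unfolding gderiv_def by (rule has_derivative_eq_rhs)
  then show ?thesis
    unfolding grad_def by (blast intro: theI GDERIV_unique)
qed

lemma grad_eqI:
  fixes f :: "'a::euclidean_space \<Rightarrow> real"
  assumes "GDERIV f x :> g"
  shows "grad f x = g"
proof (rule GDERIV_unique[OF GDERIV_grad assms])
  show "f differentiable (at x)"
    using assms unfolding gderiv_def differentiable_def by blast
qed

lemma GDERIV_along_line:
  fixes f :: "'a::euclidean_space \<Rightarrow> real"
  assumes "GDERIV f (x + t *\<^sub>R h) :> g"
  shows "((\<lambda>s. f (x + s *\<^sub>R h)) has_real_derivative (h \<bullet> g)) (at t)"
proof -
  have "(f \<circ> (\<lambda>s. x + s *\<^sub>R h) has_derivative (\<lambda>k. k \<bullet> g) \<circ> (\<lambda>s. s *\<^sub>R h)) (at t)"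
    by (rule diff_chain_at) (use assms in \<open>auto simp: gderiv_def intro!: derivative_eq_intros\<close>)
  then show ?thesis
    by (simp add: has_field_derivative_def o_def mult_commute_abs)
qed

text \<open>Restriction to the line through \<open>x\<close> and \<open>y\<close> reduces this to
  the one-dimensional tangent inequality.\<close>

lemma convex_above_tangent:
  fixes f :: "'a::euclidean_space \<Rightarrow> real"
  assumes "convex_on UNIV f" and "GDERIV f x :> g"
  shows "f x + (y - x) \<bullet> g \<le> f y"
proof -
  let ?\<phi> = "\<lambda>s. f (x + s *\<^sub>R (y - x))"
  have "convex_on UNIV ?\<phi>"
  proof (rule convex_onI)
    fix t a c :: real
    assume t: "0 < t" "t < 1"
    have "x + ((1 - t) *\<^sub>R a + t *\<^sub>R c) *\<^sub>R (y - x) =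
          (1 - t) *\<^sub>R (x + a *\<^sub>R (y - x)) + t *\<^sub>R (x + c *\<^sub>R (y - x))"
      by (simp add: algebra_simps)
    then show "?\<phi> ((1 - t) *\<^sub>R a + t *\<^sub>R c) \<le> (1 - t) * ?\<phi> a + t * ?\<phi> c"
      using convex_onD[OF assms(1), of t] t by simp
  qed simp
  moreover have "(?\<phi> has_real_derivative ((y - x) \<bullet> g)) (at 0)"
    using GDERIV_along_line[of f x 0] assms(2) by simp
  ultimately have "?\<phi> 1 - ?\<phi> 0 \<ge> ((y - x) \<bullet> g) * (1 - 0)"
    by (intro convex_on_imp_above_tangent[where A = UNIV]) auto
  then show ?thesis by simp
qed

text \<open>Descent lemma: subtracting the quadratic model along the segment leaves a function whose
  derivative is nonpositive, by Cauchy-Schwarz and the Lipschitz bound on the gradient.\<close>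

lemma smooth_descent:
  fixes f :: "'a::euclidean_space \<Rightarrow> real"
  assumes "smooth L f"
  shows "f (x + h) \<le> f x + h \<bullet> grad f x + L / 2 * (norm h)\<^sup>2"
proof -
  let ?\<phi> = "\<lambda>t. f (x + t *\<^sub>R h) - t * (h \<bullet> grad f x) - L / 2 * t\<^sup>2 * (norm h)\<^sup>2"
  let ?\<phi>' = "\<lambda>t. h \<bullet> grad f (x + t *\<^sub>R h) - h \<bullet> grad f x - L * t * (norm h)\<^sup>2"
  have "?\<phi> 1 \<le> ?\<phi> 0"
  proof (rule DERIV_nonpos_imp_nonincreasing[of 0 1 ?\<phi>])
    fix t :: real
    assume t: "0 \<le> t" "t \<le> 1"
    have "((\<lambda>s. f (x + s *\<^sub>R h)) has_real_derivative (h \<bullet> grad f (x + t *\<^sub>R h))) (at t)"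
      using assms by (intro GDERIV_along_line GDERIV_grad) (simp add: smooth_def)
    then have "(?\<phi> has_real_derivative ?\<phi>' t) (at t)"
      by (auto intro!: derivative_eq_intros)
    moreover have "?\<phi>' t \<le> 0"
    proof -
      have "h \<bullet> (grad f (x + t *\<^sub>R h) - grad f x) \<le> norm h * norm (grad f (x + t *\<^sub>R h) - grad f x)"
        by (rule norm_cauchy_schwarz)
      also have "\<dots> \<le> norm h * (L * norm (x + t *\<^sub>R h - x))"
        using assms unfolding smooth_def by (intro mult_left_mono) (blast, simp)
      also have "\<dots> = L * t * (norm h)\<^sup>2"
        using t by (simp add: power2_eq_square)
      finally show ?thesis
        by (simp add: inner_diff_right)
    qed
    ultimately show "\<exists>y. (?\<phi> has_real_derivative y) (at t) \<and> y \<le> 0"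
      by blast
  qed simp
  then show ?thesis by simp
qed

text \<open>Baillon-Haddad inequality. At a point \<open>x + h\<close>, the tangent at
  \<open>y\<close> bounds \<open>f\<close> from below and the descent lemma at \<open>x\<close>
  bounds it from above; adding the resulting estimate to its copy with \<open>x\<close> and
  \<open>y\<close> exchanged removes the function values.\<close>

lemma smooth_convex_cocoercive:
  fixes f :: "'a::euclidean_space \<Rightarrow> real"
  assumes "smooth L f" and "convex_on UNIV f"
  shows "(norm (grad f x - grad f y))\<^sup>2 \<le> L * ((x - y) \<bullet> (grad f x - grad f y))"
proof -
  have L: "L > 0" and diff: "\<And>x. f differentiable (at x)"
    using assms(1) by (auto simp: smooth_def)
  have gap: "f y - f x + (x - y) \<bullet> grad f y \<le> - ((norm (grad f x - grad f y))\<^sup>2 / (2 * L))" for x y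
  proof -
    define d where "d = grad f x - grad f y"
    \<comment> \<open>This \<open>h\<close> minimises \<open>h \<bullet> d + L / 2 * |h|^2\<close>,
      so the gap obtained is the best possible.\<close>
    define h where "h = - ((1 / L) *\<^sub>R d)"
    have "f y + (x + h - y) \<bullet> grad f y \<le> f (x + h)"
      using assms(2) GDERIV_grad[OF diff] by (rule convex_above_tangent)
    also have "\<dots> \<le> f x + h \<bullet> grad f x + L / 2 * (norm h)\<^sup>2"
      using assms(1) by (rule smooth_descent)
    also have "L / 2 * (norm h)\<^sup>2 = (norm d)\<^sup>2 / (2 * L)"
      using L by (simp add: h_def power_divide power2_eq_square)
    finally have "f y - f x + (x - y) \<bullet> grad f y \<le> h \<bullet> d + (norm d)\<^sup>2 / (2 * L)"
      by (simp add: d_def inner_add_left inner_diff_left inner_diff_right)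
    also have "h \<bullet> d = - (2 * ((norm d)\<^sup>2 / (2 * L)))"
      by (simp add: h_def power2_norm_eq_inner)
    finally show ?thesis
      by (simp add: d_def)
  qed
  define Q where "Q = (norm (grad f x - grad f y))\<^sup>2 / (2 * L)"
  have "f y - f x + (x - y) \<bullet> grad f y \<le> - Q" "f x - f y + (y - x) \<bullet> grad f x \<le> - Q"
    using gap[of y x] gap[of x y] by (simp_all add: Q_def norm_minus_commute)
  then have "2 * Q \<le> (x - y) \<bullet> (grad f x - grad f y)"
    by (simp add: inner_diff_left inner_diff_right)
  then show ?thesis
    using L by (simp add: Q_def field_simps)
qed

section \<open>Extreme singular values\<close>

text \<open>Eigenvectors for distinct eigenvalues are orthogonal, hence independent. Finiteness is
  what gives \<open>Max\<close> and \<open>Min\<close> over the singular values their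
  meaning.\<close>

lemma finite_eigenvalues_self_adjoint:
  fixes f :: "'a::euclidean_space \<Rightarrow> 'a"
  assumes "\<And>x y. f x \<bullet> y = x \<bullet> f y"
  shows "finite {m. \<exists>v. v \<noteq> 0 \<and> f v = m *\<^sub>R v}"
proof -
  define S where "S = {m. \<exists>v. v \<noteq> 0 \<and> f v = m *\<^sub>R v}"
  have "\<forall>m\<in>S. \<exists>v. v \<noteq> 0 \<and> f v = m *\<^sub>R v"
    by (simp add: S_def)
  from bchoice[OF this] obtain V where V: "\<And>m. m \<in> S \<Longrightarrow> V m \<noteq> 0 \<and> f (V m) = m *\<^sub>R V m"
    by blast
  \<comment> \<open>Self-adjointness gives
    \<open>m * (V m \<bullet> V n) = n * (V m \<bullet> V n)\<close>.\<close>
  have orth: "V m \<bullet> V n = 0" if "m \<in> S" "n \<in> S" "m \<noteq> n" for m n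
    using assms[of "V m" "V n"] V that by auto
  have inj: "inj_on V S"
    using orth V by (metis inj_onI inner_eq_zero_iff)
  have "pairwise orthogonal (V ` S)" and "0 \<notin> V ` S"
    using orth V by (auto simp: pairwise_def orthogonal_def)
  then have "finite (V ` S)"
    using pairwise_orthogonal_independent independent_imp_finite by blast
  then show ?thesis
    using inj finite_imageD unfolding S_def by blast
qed

text \<open>A minimiser of the Rayleigh quotient on the unit sphere of \<open>S\<close> is an
  eigenvector. Allowing an invariant subspace lets the kernel of a Gram matrix be excluded, and
  applying the result to \<open>- f\<close> yields the largest eigenvalue.\<close>

lemma self_adjoint_least_eigenvector:
  fixes f :: "'a::euclidean_space \<Rightarrow> 'a"
  assumes "linear f" and sym: "\<And>x y. f x \<bullet> y = x \<bullet> f y"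
    and "subspace S" and "f ` S \<subseteq> S" and "S \<noteq> {0}"
  obtains v m where "v \<in> S" "v \<noteq> 0" "f v = m *\<^sub>R v" "\<And>x. x \<in> S \<Longrightarrow> m * (norm x)\<^sup>2 \<le> x \<bullet> f x"
proof -
  interpret linear f by fact
  have unit: "(1 / norm x) *\<^sub>R x \<in> S \<inter> sphere 0 1" if "x \<in> S" "x \<noteq> 0" for x
    using that \<open>subspace S\<close> by (simp add: subspace_scale)
  have "compact (S \<inter> sphere 0 1)"
    using \<open>subspace S\<close> by (intro closed_Int_compact closed_subspace compact_sphere)
  moreover have "S \<inter> sphere 0 1 \<noteq> {}"
    using unit subspace_0[OF \<open>subspace S\<close>] \<open>S \<noteq> {0}\<close> by blast
  moreover have "continuous_on (S \<inter> sphere 0 1) (\<lambda>x. x \<bullet> f x)"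
    using \<open>linear f\<close> by (intro continuous_intros linear_continuous_on linear_conv_bounded_linear[THEN iffD1])
  ultimately have "\<exists>v\<in>S \<inter> sphere 0 1. \<forall>x\<in>S \<inter> sphere 0 1. v \<bullet> f v \<le> x \<bullet> f x"
    by (rule continuous_attains_inf)
  then obtain v where "v \<in> S \<inter> sphere 0 1"
    and min: "\<And>x. x \<in> S \<inter> sphere 0 1 \<Longrightarrow> v \<bullet> f v \<le> x \<bullet> f x"
    by blast
  then have v: "v \<in> S" "norm v = 1"
    by auto
  define m where "m = v \<bullet> f v"
  have low: "m * (norm x)\<^sup>2 \<le> x \<bullet> f x" if "x \<in> S" for x
  proof (cases "x = 0")
    case False
    then have "m \<le> ((1 / norm x) *\<^sub>R x) \<bullet> f ((1 / norm x) *\<^sub>R x)"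
      unfolding m_def using min unit that by blast
    also have "\<dots> = (x \<bullet> f x) / (norm x)\<^sup>2"
      by (simp add: scale power2_eq_square)
    finally show ?thesis
      using False by (simp add: field_simps)
  qed simp
  define r where "r = f v - m *\<^sub>R v"
  have "r \<in> S"
    unfolding r_def using v(1) assms(3,4) by (intro subspace_diff subspace_scale) auto
  define c where "c = r \<bullet> f r - m * (norm r)\<^sup>2"
  have "c \<ge> 0"
    using low[OF \<open>r \<in> S\<close>] by (simp add: c_def)
  \<comment> \<open>The form \<open>x \<bullet> f x - m \<bar>x\<bar>\<^sup>2\<close> is nonnegative on \<open>S\<close> and vanishes at \<open>v\<close>, where its
    derivative in the direction \<open>r\<close> is \<open>2 \<bar>r\<bar>\<^sup>2\<close>.\<close>
  have quad: "0 \<le> 2 * t * (norm r)\<^sup>2 + t\<^sup>2 * c" for t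
  proof -
    have "m * (norm (v + t *\<^sub>R r))\<^sup>2 \<le> (v + t *\<^sub>R r) \<bullet> f (v + t *\<^sub>R r)"
      using low v \<open>r \<in> S\<close> \<open>subspace S\<close> by (simp add: subspace_add subspace_scale)
    moreover have "(norm (v + t *\<^sub>R r))\<^sup>2 = 1 + 2 * t * (v \<bullet> r) + t\<^sup>2 * (norm r)\<^sup>2"
      using v(2) unfolding power2_norm_eq_inner norm_eq_1
      by (simp add: inner_add inner_commute power2_eq_square)
    moreover have "(v + t *\<^sub>R r) \<bullet> f (v + t *\<^sub>R r) = m + 2 * t * (r \<bullet> f v) + t\<^sup>2 * (r \<bullet> f r)"
      using sym[of v r] by (simp add: m_def add scale inner_add inner_commute power2_eq_square)
    moreover have "r \<bullet> f v = m * (v \<bullet> r) + (norm r)\<^sup>2"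
      unfolding power2_norm_eq_inner r_def by (simp add: inner_diff inner_commute algebra_simps)
    ultimately show ?thesis
      by (simp add: c_def algebra_simps)
  qed
  \<comment> \<open>A small negative \<open>t\<close> would make the form negative unless
    \<open>r = 0\<close>. With \<open>t = - s\<close> the quadratic collapses to
    \<open>- s^2 * (c + 2)\<close>; the \<open>+ 1\<close> keeps the denominator positive when
    \<open>c = 0\<close>.\<close>
  have "(norm r)\<^sup>2 = 0"
  proof -
    define s where "s = (norm r)\<^sup>2 / (c + 1)"
    have r: "(norm r)\<^sup>2 = s * (c + 1)"
      using \<open>c \<ge> 0\<close> by (simp add: s_def)
    have "0 \<le> - (s\<^sup>2 * (c + 2))"
      using quad[of "- s"] unfolding r by (simp add: algebra_simps power2_eq_square)
    then have "s\<^sup>2 * (c + 2) \<le> 0"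
      by simp
    then have "s = 0"
      using \<open>c \<ge> 0\<close> by (simp add: mult_le_0_iff)
    then show ?thesis
      by (simp add: r)
  qed
  then have "f v = m *\<^sub>R v"
    by (simp add: r_def)
  moreover have "v \<noteq> 0"
    using v by auto
  ultimately show thesis
    using that v low by blast
qed

section \<open>Gram matrix and largest singular value\<close>

text \<open>As a simp rule this would turn \<open>transpose A *v x\<close> into
  \<open>x v* A\<close> and hide the adjoint that the lemmas below rewrite with.\<close>

declare transpose_matrix_vector [simp del]

lemma transpose_mult_inner: "(transpose A *v x) \<bullet> y = x \<bullet> (A *v y)" for A :: "real ^ 'm ^ 'e"
  by (simp add: transpose_matrix_vector dot_lmul_matrix)

lemma gram_mult: "(transpose A ** A) *v x = transpose A *v (A *v x)" for A :: "real ^ 'm ^ 'e"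
  by (simp add: matrix_vector_mul_assoc)

lemma gram_inner: "x \<bullet> ((transpose A ** A) *v x) = (norm (A *v x))\<^sup>2" for A :: "real ^ 'm ^ 'e"
  by (metis gram_mult inner_commute power2_norm_eq_inner transpose_mult_inner)

lemma gram_self_adjoint:
  "((transpose A ** A) *v x) \<bullet> y = x \<bullet> ((transpose A ** A) *v y)" for A :: "real ^ 'm ^ 'e"
  by (metis gram_mult inner_commute transpose_mult_inner)

text \<open>Needed because \<open>sqrt\<close> of a negative real is negative in HOL, so the
  elements of \<open>singular_values\<close> are not nonnegative by form alone.\<close>

lemma gram_eigenvalue_nonneg:
  fixes A :: "real ^ 'm ^ 'e"
  assumes "v \<noteq> 0" and "(transpose A ** A) *v v = m *\<^sub>R v"
  shows "m \<ge> 0"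
proof -
  have "m * (norm v)\<^sup>2 = (norm (A *v v))\<^sup>2"
    using gram_inner[of v A] assms(2) by (simp add: power2_norm_eq_inner)
  then show ?thesis
    using assms(1) by (metis norm_eq_zero zero_le_mult_iff zero_le_power2 zero_less_power2 linorder_not_le)
qed

lemma finite_singular_values: "finite (singular_values A)"
proof -
  have "singular_values A = sqrt ` {m. \<exists>v. v \<noteq> 0 \<and> (transpose A ** A) *v v = m *\<^sub>R v}"
    by (auto simp: singular_values_def)
  then show ?thesis
    using finite_eigenvalues_self_adjoint[of "(*v) (transpose A ** A)", OF gram_self_adjoint] by simp
qed

lemma singular_values_nonneg: "s \<in> singular_values A \<Longrightarrow> 0 \<le> s"
  by (auto simp: singular_values_def dest: gram_eigenvalue_nonneg)

text \<open>The least eigenvalue \<open>m\<close> of the negated Gram matrix gives its largest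
  eigenvalue \<open>- m\<close>, whose square root is a singular value.\<close>

lemma norm_mult_le_sigma_max:
  fixes A :: "real ^ 'm ^ 'e"
  shows "(norm (A *v x))\<^sup>2 \<le> (sigma_max A)\<^sup>2 * (norm x)\<^sup>2"
proof -
  let ?f = "\<lambda>x. - ((transpose A ** A) *v x)"
  have lin: "linear ?f"
    by (intro linear_compose_neg matrix_vector_mul_linear)
  have sym: "?f x \<bullet> y = x \<bullet> ?f y" for x y
    by (simp add: gram_self_adjoint)
  obtain v m where v: "v \<noteq> 0" "?f v = m *\<^sub>R v"
    and bound: "\<And>x. m * (norm x)\<^sup>2 \<le> x \<bullet> ?f x"
    using self_adjoint_least_eigenvector[OF lin sym subspace_UNIV subset_UNIV UNIV_not_singleton]
    by auto
  have eig: "(transpose A ** A) *v v = (- m) *\<^sub>R v"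
    using v(2) by (metis minus_equation_iff scaleR_minus_left)
  have "- m \<ge> 0"
    using v(1) eig by (rule gram_eigenvalue_nonneg)
  have "sqrt (- m) \<in> singular_values A"
    using v(1) eig by (auto simp: singular_values_def)
  then have "sqrt (- m) \<le> sigma_max A"
    unfolding sigma_max_def using finite_singular_values by (rule Max_ge[rotated])
  then have "- m \<le> (sigma_max A)\<^sup>2"
    using \<open>- m \<ge> 0\<close> by (metis real_sqrt_ge_zero real_sqrt_pow2 power_mono)
  then have "- m * (norm x)\<^sup>2 \<le> (sigma_max A)\<^sup>2 * (norm x)\<^sup>2"
    by (rule mult_right_mono) simp
  moreover have "(norm (A *v x))\<^sup>2 \<le> - m * (norm x)\<^sup>2"
    using bound[of x] by (simp add: gram_inner)
  ultimately show ?thesis by linarith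
qed

lemma sigma_max_nonneg: "sigma_max A \<ge> 0" for A :: "real ^ 'm ^ 'e"
proof -
  obtain v m where "v \<noteq> 0" "(transpose A ** A) *v v = m *\<^sub>R v"
    using self_adjoint_least_eigenvector[OF matrix_vector_mul_linear gram_self_adjoint subspace_UNIV
        subset_UNIV UNIV_not_singleton] .
  then have "singular_values A \<noteq> {}"
    by (auto simp: singular_values_def)
  then show ?thesis
    unfolding sigma_max_def using finite_singular_values Max_in singular_values_nonneg by blast
qed

lemma norm_mult_le_sigma_max': "norm (A *v x) \<le> sigma_max A * norm x" for A :: "real ^ 'm ^ 'e"
  using norm_mult_le_sigma_max[of A x] sigma_max_nonneg[of A]
  by (metis abs_le_square_iff abs_norm_cancel abs_of_nonneg norm_ge_zero power_mult_distrib mult_nonneg_nonneg)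

text \<open>The bound for \<open>A\<close> passes to its adjoint by Cauchy-Schwarz and cancellation
  of one factor \<open>norm (transpose A *v y)\<close>, without comparing the spectra of the two
  Gram matrices.\<close>

lemma norm_transpose_mult_le_sigma_max:
  fixes A :: "real ^ 'm ^ 'e"
  shows "norm (transpose A *v y) \<le> sigma_max A * norm y"
proof (cases "transpose A *v y = 0")
  case True
  then show ?thesis
    by (simp add: sigma_max_nonneg)
next
  case False
  have "(norm (transpose A *v y))\<^sup>2 = y \<bullet> (A *v (transpose A *v y))"
    by (simp add: power2_norm_eq_inner transpose_mult_inner)
  also have "\<dots> \<le> norm y * (sigma_max A * norm (transpose A *v y))"
    by (meson norm_cauchy_schwarz norm_mult_le_sigma_max' mult_left_mono norm_ge_zero order_trans)
  finally show ?thesis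
    using False by (simp add: power2_eq_square mult.commute)
qed

section \<open>Range, kernel of the transpose and smallest non-zero singular value\<close>

lemma matrix_range_subspace: "subspace (range ((*v) A))" for A :: "real ^ 'm ^ 'e"
  by (simp add: linear_subspace_image)

lemma transpose_mult_eq_0_on_range:
  fixes A :: "real ^ 'm ^ 'e"
  assumes "y \<in> range ((*v) A)" and "transpose A *v y = 0"
  shows "y = 0"
  using assms by (metis imageE inner_eq_zero_iff inner_zero_left transpose_mult_inner)

text \<open>The orthogonal complement of the range of \<open>A\<close> is the kernel of its
  transpose.\<close>

lemma range_orthogonal_decomposition:
  fixes A :: "real ^ 'm ^ 'e"
  obtains x z where "y = A *v x + z" "transpose A *v z = 0"
proof -
  obtain u z where u: "u \<in> span (range ((*v) A))" and z: "\<And>w. w \<in> span (range ((*v) A)) \<Longrightarrow> orthogonal z w"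
    and "y = u + z"
    using orthogonal_subspace_decomp_exists[of "range ((*v) A)" y] by blast
  moreover have "span (range ((*v) A)) = range ((*v) A)"
    by (simp add: matrix_range_subspace)
  ultimately obtain x where "y = A *v x + z" and z: "\<And>w. orthogonal z (A *v w)"
    by auto
  moreover have "transpose A *v z = 0"
    using z by (metis inner_eq_zero_iff orthogonal_def transpose_mult_inner)
  ultimately show thesis
    using that by blast
qed

text \<open>On the row space \<open>?S\<close> the Gram matrix has a least eigenvalue
  \<open>m\<close>, and \<open>m > 0\<close> because \<open>A\<close> is injective there. Its root
  is a non-zero singular value, so the minimum is at most \<open>sqrt m\<close>. The lower bound for
  \<open>A\<close> on \<open>?S\<close> is then carried over to the transpose on the range of
  \<open>A\<close>.\<close>

lemma sigma_min_nonzero_bound: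
  fixes A :: "real ^ 'm ^ 'e"
  assumes "A \<noteq> 0"
  shows "sigma_min_nonzero A > 0"
    and "y \<in> range ((*v) A) \<Longrightarrow> (sigma_min_nonzero A)\<^sup>2 * (norm y)\<^sup>2 \<le> (norm (transpose A *v y))\<^sup>2"
proof -
  let ?S = "range ((*v) (transpose A))"
  have "?S \<noteq> {0}"
  proof
    assume "?S = {0}"
    then have "transpose A *v y = 0" for y
      by blast
    then have "transpose A = 0"
      by (simp add: matrix_eq)
    then have "transpose (transpose A) = 0"
      by (simp add: transpose_def vec_eq_iff)
    then show False
      using assms by simp
  qed
  moreover have "(*v) (transpose A ** A) ` ?S \<subseteq> ?S"
    using gram_mult by auto
  ultimately obtain v m where v: "v \<in> ?S" "v \<noteq> 0" "(transpose A ** A) *v v = m *\<^sub>R v"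
    and low: "\<And>x. x \<in> ?S \<Longrightarrow> m * (norm x)\<^sup>2 \<le> (norm (A *v x))\<^sup>2"
    using self_adjoint_least_eigenvector[OF matrix_vector_mul_linear gram_self_adjoint
        matrix_range_subspace, of A "transpose A"]
    unfolding gram_inner by blast
  have "m \<noteq> 0"
  proof
    assume "m = 0"
    then have "A *v v = 0"
      using gram_inner[of v A] v(3) by simp
    then show False
      using transpose_mult_eq_0_on_range[of v "transpose A"] v by simp
  qed
  then have "m > 0"
    using gram_eigenvalue_nonneg v by force
  have sv: "sqrt m \<in> singular_values A - {0}"
    using v \<open>m > 0\<close> by (auto simp: singular_values_def)
  have fin: "finite (singular_values A - {0})"
    by (simp add: finite_singular_values)
  have "sigma_min_nonzero A \<in> singular_values A - {0}"
    unfolding sigma_min_nonzero_def using Min_in[OF fin] sv by blast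
  then show pos: "sigma_min_nonzero A > 0"
    using singular_values_nonneg by force
  have "sigma_min_nonzero A \<le> sqrt m"
    unfolding sigma_min_nonzero_def using fin sv by (rule Min_le)
  then have sm: "(sigma_min_nonzero A)\<^sup>2 \<le> m"
    using pos \<open>m > 0\<close> by (metis less_imp_le power_mono real_sqrt_pow2)
  show "(sigma_min_nonzero A)\<^sup>2 * (norm y)\<^sup>2 \<le> (norm (transpose A *v y))\<^sup>2"
    if y: "y \<in> range ((*v) A)"
  proof -
    obtain x0 where "y = A *v x0"
      using y by blast
    \<comment> \<open>Dropping the kernel component \<open>z\<close> of \<open>x0\<close> moves the
      preimage of \<open>y\<close> into the row space, where \<open>low\<close> applies.\<close>
    moreover obtain u z where "x0 = transpose A *v u + z" "A *v z = 0"
      using range_orthogonal_decomposition[of x0 "transpose A"] by auto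
    ultimately have "y = A *v (transpose A *v u)"
      by (simp add: matrix_vector_right_distrib)
    then obtain x where x: "x \<in> ?S" "y = A *v x"
      by blast
    have "(norm y)\<^sup>2 = x \<bullet> (transpose A *v y)"
      by (metis gram_inner gram_mult x(2))
    also have "\<dots> \<le> norm x * norm (transpose A *v y)"
      by (rule norm_cauchy_schwarz)
    finally have "((norm y)\<^sup>2)\<^sup>2 \<le> (norm x * norm (transpose A *v y))\<^sup>2"
      by (rule power_mono) simp
    \<comment> \<open>Next \<open>low\<close> bounds \<open>m * |x|^2\<close> by
      \<open>|A x|^2 = |y|^2\<close>, which eliminates \<open>x\<close>; one factor
      \<open>|y|^2\<close> is then cancelled.\<close>
    then have "m * ((norm y)\<^sup>2)\<^sup>2 \<le> m * (norm x)\<^sup>2 * (norm (transpose A *v y))\<^sup>2"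
      using \<open>m > 0\<close> by (simp add: power_mult_distrib)
    also have "\<dots> \<le> (norm y)\<^sup>2 * (norm (transpose A *v y))\<^sup>2"
      using low x by (intro mult_right_mono) auto
    finally have "(norm y)\<^sup>2 * (m * (norm y)\<^sup>2) \<le> (norm y)\<^sup>2 * (norm (transpose A *v y))\<^sup>2"
      by (simp add: power2_eq_square mult.assoc mult.left_commute)
    then have "m * (norm y)\<^sup>2 \<le> (norm (transpose A *v y))\<^sup>2"
      by (cases "y = 0") auto
    moreover have "(sigma_min_nonzero A)\<^sup>2 * (norm y)\<^sup>2 \<le> m * (norm y)\<^sup>2"
      using sm by (rule mult_right_mono) simp
    ultimately show ?thesis
      by linarith
  qed
qed

section \<open>The augmented cost and the dual variable\<close>

lemma grad_augmented_cost:
  fixes J :: "real ^ 'm \<Rightarrow> real"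
  assumes "J differentiable (at x)"
  shows "augmented_cost J B b \<rho> differentiable (at x)"
    and "grad (augmented_cost J B b \<rho>) x = grad J x + \<rho> *\<^sub>R (transpose B *v (B *v x - b))"
proof -
  have J: "(J has_derivative (\<lambda>h. h \<bullet> grad J x)) (at x)"
    using GDERIV_grad[OF assms] by (simp add: gderiv_def)
  have B: "((*v) B has_derivative (*v) B) (at x)"
    by (simp add: bounded_linear_imp_has_derivative)
  have "((\<lambda>x. J x + \<rho> / 2 * ((B *v x - b) \<bullet> (B *v x - b))) has_derivative
      (\<lambda>h. h \<bullet> grad J x + \<rho> / 2 * ((B *v x - b) \<bullet> (B *v h) + (B *v h) \<bullet> (B *v x - b)))) (at x)"
    by (rule derivative_eq_intros J B refl | simp)+
  moreover have "h \<bullet> grad J x + \<rho> / 2 * ((B *v x - b) \<bullet> (B *v h) + (B *v h) \<bullet> (B *v x - b)) =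
      h \<bullet> (grad J x + \<rho> *\<^sub>R (transpose B *v (B *v x - b)))" for h
    by (simp add: inner_add_right inner_commute[of h] transpose_mult_inner inner_commute[of "B *v h"])
  ultimately have "GDERIV (augmented_cost J B b \<rho>) x :> grad J x + \<rho> *\<^sub>R (transpose B *v (B *v x - b))"
    unfolding gderiv_def augmented_cost_def[abs_def] power2_norm_eq_inner by simp
  then show "augmented_cost J B b \<rho> differentiable (at x)"
    and "grad (augmented_cost J B b \<rho>) x = grad J x + \<rho> *\<^sub>R (transpose B *v (B *v x - b))"
    by (auto simp: gderiv_def differentiable_def intro: grad_eqI)
qed

text \<open>The penalty adds the linear map \<open>\<rho> B^T B\<close> to the gradient, and each of
  the two factors contributes one \<open>sigma_max B\<close> to the Lipschitz constant.\<close>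

lemma smooth_augmented_cost:
  fixes J :: "real ^ 'm \<Rightarrow> real" and B :: "real ^ 'm ^ 'e"
  assumes "smooth \<delta> J" and "\<rho> \<ge> 0"
  shows "smooth (\<delta> + \<rho> * (sigma_max B)\<^sup>2) (augmented_cost J B b \<rho>)"
  unfolding smooth_def
proof (intro conjI allI)
  have diff: "J differentiable (at x)" for x
    using assms(1) by (simp add: smooth_def)
  show "\<delta> + \<rho> * (sigma_max B)\<^sup>2 > 0"
    using assms by (simp add: smooth_def add_pos_nonneg)
  show "augmented_cost J B b \<rho> differentiable (at x)" for x
    using diff by (rule grad_augmented_cost)
  fix x y
  have "grad (augmented_cost J B b \<rho>) x - grad (augmented_cost J B b \<rho>) y =
      (grad J x - grad J y) + \<rho> *\<^sub>R (transpose B *v (B *v (x - y)))"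
    by (simp add: grad_augmented_cost diff matrix_vector_mult_diff_distrib algebra_simps)
  also have "norm \<dots> \<le> norm (grad J x - grad J y) + norm (\<rho> *\<^sub>R (transpose B *v (B *v (x - y))))"
    by (rule norm_triangle_ineq)
  also have "\<dots> \<le> \<delta> * norm (x - y) + \<rho> * ((sigma_max B)\<^sup>2 * norm (x - y))"
  proof -
    have "norm (transpose B *v (B *v (x - y))) \<le> sigma_max B * norm (B *v (x - y))"
      by (rule norm_transpose_mult_le_sigma_max)
    also have "\<dots> \<le> sigma_max B * (sigma_max B * norm (x - y))"
      by (intro mult_left_mono norm_mult_le_sigma_max' sigma_max_nonneg)
    finally have "norm (transpose B *v (B *v (x - y))) \<le> (sigma_max B)\<^sup>2 * norm (x - y)"
      by (simp add: power2_eq_square)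
    then show ?thesis
      using assms by (auto simp: smooth_def intro!: add_mono mult_left_mono)
  qed
  finally show "norm (grad (augmented_cost J B b \<rho>) x - grad (augmented_cost J B b \<rho>) y)
      \<le> (\<delta> + \<rho> * (sigma_max B)\<^sup>2) * norm (x - y)"
    by (simp add: algebra_simps)
qed

lemma convex_augmented_cost:
  fixes J :: "real ^ 'm \<Rightarrow> real"
  assumes "convex_on UNIV J" and "\<rho> \<ge> 0"
  shows "convex_on UNIV (augmented_cost J B b \<rho>)"
proof -
  have "convex_on UNIV (\<lambda>x. (norm (B *v x - b))\<^sup>2)"
  proof (rule convex_onI)
    fix t :: real and x y
    assume t: "0 < t" "t < 1"
    define p q where "p = B *v x - b" and "q = B *v y - b"
    have "B *v ((1 - t) *\<^sub>R x + t *\<^sub>R y) - b = (1 - t) *\<^sub>R p + t *\<^sub>R q"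
      by (simp add: p_def q_def matrix_vector_right_distrib matrix_vector_mult_scaleR algebra_simps)
    \<comment> \<open>The convexity gap of the squared norm is an exact identity, visibly
      nonnegative.\<close>
    moreover have "(1 - t) * (norm p)\<^sup>2 + t * (norm q)\<^sup>2 - (norm ((1 - t) *\<^sub>R p + t *\<^sub>R q))\<^sup>2 =
        t * (1 - t) * (norm (p - q))\<^sup>2"
      unfolding power2_norm_eq_inner
      by (simp add: inner_add inner_diff inner_commute algebra_simps)
    moreover have "t * (1 - t) * (norm (p - q))\<^sup>2 \<ge> 0"
      using t by simp
    ultimately show "(norm (B *v ((1 - t) *\<^sub>R x + t *\<^sub>R y) - b))\<^sup>2 \<le>
        (1 - t) * (norm (B *v x - b))\<^sup>2 + t * (norm (B *v y - b))\<^sup>2"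
      by (simp add: p_def q_def)
  qed simp
  then show ?thesis
    unfolding augmented_cost_def[abs_def] using assms
    by (intro convex_on_add convex_on_cmul) auto
qed

section \<open>Lagrange multiplier in the range of the constraint matrix\<close>

text \<open>At a constrained minimiser the gradient is orthogonal to the kernel of \<open>B\<close>,
  hence lies in the range of the transpose. Projecting a multiplier onto the range of
  \<open>B\<close> keeps its image under the transpose, and the transpose is injective on that
  range.\<close>

lemma ex1_range_optimal_dual:
  fixes J :: "real ^ 'm \<Rightarrow> real"
  assumes "J differentiable (at x)" and "is_arg_min J (\<lambda>x. B *v x = b) x"
  shows "\<exists>!l. optimal_dual J B b x l \<and> l \<in> range ((*v) B)"
proof -
  have feas: "B *v x = b" and min: "\<And>y. B *v y = b \<Longrightarrow> J x \<le> J y"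
    using assms(2) by (auto simp: is_arg_min_linorder)
  \<comment> \<open>Moving along a kernel direction stays feasible for both signs of
    \<open>s\<close>, so the one-dimensional derivative vanishes at \<open>0\<close>.\<close>
  have ker: "h \<bullet> grad J x = 0" if "B *v h = 0" for h
  proof (rule DERIV_local_min)
    show "((\<lambda>s. J (x + s *\<^sub>R h)) has_real_derivative (h \<bullet> grad J x)) (at 0)"
      using GDERIV_along_line[of J x 0] GDERIV_grad[OF assms(1)] by simp
    show "\<forall>s. \<bar>0 - s\<bar> < 1 \<longrightarrow> J (x + 0 *\<^sub>R h) \<le> J (x + s *\<^sub>R h)"
      using feas that by (auto intro!: min simp: matrix_vector_right_distrib matrix_vector_mult_scaleR)
  qed simp
  obtain u z where u: "- grad J x = transpose B *v u + z" and z: "B *v z = 0"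
    using range_orthogonal_decomposition[of "- grad J x" "transpose B"] by auto
  \<comment> \<open>Both terms on the right vanish: the first by \<open>ker\<close>, the second
    because \<open>B *v z = 0\<close>.\<close>
  have "z \<bullet> z = z \<bullet> (- grad J x) - (transpose B *v u) \<bullet> z"
    by (simp add: u inner_add_right inner_commute)
  then have "z = 0"
    using ker[OF z] z by (simp add: transpose_mult_inner)
  moreover obtain v y where "u = B *v v + y" "transpose B *v y = 0"
    using range_orthogonal_decomposition[of u B] .
  ultimately have "- grad J x = transpose B *v (B *v v)"
    using u by (simp add: matrix_vector_right_distrib)
  then have "grad J x + transpose B *v (B *v v) = 0"
    by (metis add.right_inverse)
  then have "optimal_dual J B b x (B *v v)"
    using feas by (simp add: optimal_dual_def)
  moreover have "l = l'" if "optimal_dual J B b x l" "l \<in> range ((*v) B)"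
    "optimal_dual J B b x l'" "l' \<in> range ((*v) B)" for l l'
  proof -
    have "transpose B *v (l - l') = 0"
      using that unfolding optimal_dual_def
      by (metis add_left_cancel cancel_comm_monoid_add_class.diff_cancel matrix_vector_mult_diff_distrib)
    moreover have "l - l' \<in> range ((*v) B)"
      using that by (intro subspace_diff matrix_range_subspace)
    ultimately show ?thesis
      using transpose_mult_eq_0_on_range by fastforce
  qed
  ultimately show ?thesis
    by blast
qed

section \<open>Linear convergence\<close>

text \<open>The weighted energy \<open>V\<close> is quadratic, so the norm decays at rate
  \<open>sqrt q\<close>; \<open>k = min a c\<close> compares \<open>V\<close> with the squared
  product norm.\<close>

lemma converges_linearly_of_contraction:
  fixes x :: "nat \<Rightarrow> 'a::real_inner" and y :: "nat \<Rightarrow> 'b::real_inner"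
  assumes "a > 0" and "c > 0" and "0 \<le> q" and "q < 1"
    and step: "\<And>i. a * (norm (x (Suc i) - x'))\<^sup>2 + c * (norm (y (Suc i) - y'))\<^sup>2
      \<le> q * (a * (norm (x i - x'))\<^sup>2 + c * (norm (y i - y'))\<^sup>2)"
  shows "converges_linearly (\<lambda>i. (x i, y i)) (x', y')"
proof -
  define V where "V i = a * (norm (x i - x'))\<^sup>2 + c * (norm (y i - y'))\<^sup>2" for i
  define k where "k = min a c"
  have "k > 0"
    using assms by (simp add: k_def)
  have V: "V i \<le> q ^ i * V 0" for i
  proof (induction i)
    case (Suc i)
    have "V (Suc i) \<le> q * V i"
      using step by (simp add: V_def)
    also have "\<dots> \<le> q * (q ^ i * V 0)"
      using Suc \<open>0 \<le> q\<close> by (rule mult_left_mono)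
    finally show ?case
      by (simp add: mult.assoc)
  qed simp
  have "norm ((x i, y i) - (x', y')) \<le> sqrt (V 0 / k) * sqrt q ^ i" for i
  proof -
    have "k * ((norm (x i - x'))\<^sup>2 + (norm (y i - y'))\<^sup>2) \<le> V i"
      unfolding V_def distrib_left k_def by (intro add_mono mult_right_mono) auto
    also note V
    finally have "(norm (x i - x'))\<^sup>2 + (norm (y i - y'))\<^sup>2 \<le> V 0 / k * q ^ i"
      using \<open>k > 0\<close> by (simp add: field_simps)
    then have "sqrt ((norm (x i - x'))\<^sup>2 + (norm (y i - y'))\<^sup>2) \<le> sqrt (V 0 / k * q ^ i)"
      by (rule real_sqrt_le_mono)
    then show ?thesis
      by (simp only: diff_Pair norm_Pair real_sqrt_mult real_sqrt_power)
  qed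
  then show ?thesis
    unfolding converges_linearly_def using assms
    by (intro exI[of _ "sqrt (V 0 / k)"] exI[of _ "sqrt q"]) auto
qed

section \<open>One step of the iteration\<close>

text \<open>An exact identity up to \<open>\<mu> * \<kappa> * |B x'|^2\<close>; bounding this term
  by \<open>sigma_max\<close> and moving it to the left produces the weight of
  \<open>|x'|^2\<close>.\<close>

lemma primal_dual_energy:
  fixes B :: "real ^ 'm ^ 'e"
  assumes "0 < \<mu>" and "0 < \<kappa>"
    and x': "x' = p - \<mu> *\<^sub>R (transpose B *v y)" and y': "y' = y + \<kappa> *\<^sub>R (B *v x')"
  shows "(1 - \<mu> * \<kappa> * (sigma_max B)\<^sup>2) * (norm x')\<^sup>2 + \<mu> / \<kappa> * (norm y')\<^sup>2
    \<le> (norm p)\<^sup>2 + \<mu> / \<kappa> * ((norm y)\<^sup>2 - \<mu> * \<kappa> * (norm (transpose B *v y))\<^sup>2)"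
proof -
  define t where "t = transpose B *v y"
  have "(norm x')\<^sup>2 = (norm p)\<^sup>2 - 2 * \<mu> * (t \<bullet> p) + \<mu>\<^sup>2 * (norm t)\<^sup>2"
    unfolding x' t_def[symmetric] power2_norm_eq_inner
    by (simp add: inner_diff inner_commute power2_eq_square)
  moreover have energy_y: "(norm y')\<^sup>2 = (norm y)\<^sup>2 + 2 * \<kappa> * (t \<bullet> p - \<mu> * (norm t)\<^sup>2) + \<kappa>\<^sup>2 * (norm (B *v x'))\<^sup>2"
  proof -
    have "y \<bullet> (B *v x') = t \<bullet> p - \<mu> * (norm t)\<^sup>2"
      unfolding t_def by (simp add: x' inner_diff_right power2_norm_eq_inner flip: transpose_mult_inner)
    moreover have "(norm y')\<^sup>2 = (norm y)\<^sup>2 + 2 * \<kappa> * (y \<bullet> (B *v x')) + \<kappa>\<^sup>2 * (norm (B *v x'))\<^sup>2"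
      unfolding y' power2_norm_eq_inner
      by (simp add: inner_add inner_commute power2_eq_square)
    ultimately show ?thesis by simp
  qed
  \<comment> \<open>The weight turns the cross term into \<open>2 * \<mu> * (t \<bullet> p)\<close>,
    opposite to the one in \<open>|x'|^2\<close>; of \<open>|t|^2\<close> there remains
    \<open>\<mu>^2 - 2 * \<mu>^2\<close>.\<close>
  moreover have "\<mu> / \<kappa> * (norm y')\<^sup>2 =
      \<mu> / \<kappa> * (norm y)\<^sup>2 + 2 * \<mu> * (t \<bullet> p - \<mu> * (norm t)\<^sup>2) + \<mu> * \<kappa> * (norm (B *v x'))\<^sup>2"
    unfolding energy_y using assms(2) by (simp add: field_simps power2_eq_square)
  ultimately have "(norm x')\<^sup>2 + \<mu> / \<kappa> * (norm y')\<^sup>2 =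
      (norm p)\<^sup>2 + \<mu> / \<kappa> * ((norm y)\<^sup>2 - \<mu> * \<kappa> * (norm t)\<^sup>2) + \<mu> * \<kappa> * (norm (B *v x'))\<^sup>2"
    using assms(2) by (simp add: right_diff_distrib power2_eq_square)
  moreover have "\<mu> * \<kappa> * (norm (B *v x'))\<^sup>2 \<le> \<mu> * \<kappa> * ((sigma_max B)\<^sup>2 * (norm x')\<^sup>2)"
    using assms norm_mult_le_sigma_max by (intro mult_left_mono) auto
  ultimately show ?thesis
    unfolding t_def by (simp add: algebra_simps)
qed

text \<open>Co-coercivity absorbs \<open>|g|^2\<close> into \<open>x \<bullet> g\<close>. The
  remaining coefficient \<open>- \<mu> * (2 - \<mu> * L)\<close> is negative, so the lower bound on
  \<open>x \<bullet> g\<close> can then be inserted.\<close>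

lemma gradient_step_bound:
  fixes x g :: "'a::real_inner"
  assumes "0 < \<mu>" and "\<mu> * L < 1"
    and "\<nu> * (norm x)\<^sup>2 \<le> x \<bullet> g" and "(norm g)\<^sup>2 \<le> L * (x \<bullet> g)"
  shows "(norm (x - \<mu> *\<^sub>R g))\<^sup>2 \<le> (1 - \<mu> * \<nu> * (2 - \<mu> * L)) * (norm x)\<^sup>2"
proof -
  have "(norm (x - \<mu> *\<^sub>R g))\<^sup>2 = (norm x)\<^sup>2 - 2 * \<mu> * (x \<bullet> g) + \<mu>\<^sup>2 * (norm g)\<^sup>2"
    unfolding power2_norm_eq_inner by (simp add: inner_diff inner_commute power2_eq_square)
  also have "\<dots> \<le> (norm x)\<^sup>2 - 2 * \<mu> * (x \<bullet> g) + \<mu>\<^sup>2 * (L * (x \<bullet> g))"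
    using assms by (intro add_left_mono mult_left_mono) auto
  also have "\<dots> = (norm x)\<^sup>2 - \<mu> * (2 - \<mu> * L) * (x \<bullet> g)"
    by (simp add: algebra_simps power2_eq_square)
  also have "\<dots> \<le> (norm x)\<^sup>2 - \<mu> * (2 - \<mu> * L) * (\<nu> * (norm x)\<^sup>2)"
    using assms by (intro diff_left_mono mult_left_mono) auto
  finally show ?thesis
    by (simp add: algebra_simps)
qed

theorem theorem1:
  fixes B :: "real ^ 'm ^ 'e" and b :: "real ^ 'e" and J :: "real ^ 'm \<Rightarrow> real"
    and \<rho> \<delta> \<delta>\<^sub>\<rho> \<nu>\<^sub>\<rho> \<mu>\<^sub>w \<mu>\<^sub>l c\<^sub>w \<gamma> :: real
    and w_star :: "real ^ 'm" and lam_b_star :: "real ^ 'e"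
    and w :: "nat \<Rightarrow> real ^ 'm" and lam :: "nat \<Rightarrow> real ^ 'e"
  assumes "B \<noteq> 0"
    and "\<rho> \<ge> 0"
    and "convex_on UNIV J"
    and "smooth \<delta> J"
    and "unique_solution J B b w_star"
    and "\<delta>\<^sub>\<rho> = \<delta> + \<rho> * (sigma_max B)\<^sup>2"
    and "strongly_convex_wrt \<nu>\<^sub>\<rho> (augmented_cost J B b \<rho>) w_star"
    and "0 < \<nu>\<^sub>\<rho>" and "\<nu>\<^sub>\<rho> \<le> \<delta>\<^sub>\<rho>"
    and "0 < \<mu>\<^sub>w" and "\<mu>\<^sub>w < 1 / \<delta>\<^sub>\<rho>"
    and "0 < \<mu>\<^sub>l" and "\<mu>\<^sub>l \<le> \<nu>\<^sub>\<rho> / (sigma_max B)\<^sup>2"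
    and "primal_dual_iterates J B b \<rho> \<mu>\<^sub>w \<mu>\<^sub>l w lam"
    and "lam_b_star = range_optimal_dual J B b w_star"
    and "c\<^sub>w = 1 - \<mu>\<^sub>w * \<mu>\<^sub>l * (sigma_max B)\<^sup>2"
    and "\<gamma> = max (1 - \<mu>\<^sub>w * \<nu>\<^sub>\<rho> * (1 - \<mu>\<^sub>w * \<delta>\<^sub>\<rho>))
                 (1 - \<mu>\<^sub>w * \<mu>\<^sub>l * (sigma_min_nonzero B)\<^sup>2)"
  shows "smooth \<delta>\<^sub>\<rho> (augmented_cost J B b \<rho>) \<and>
    (\<exists>!l. optimal_dual J B b w_star l \<and> l \<in> range ((*v) B)) \<and>
    c\<^sub>w > 0 \<and> \<gamma> < 1 \<and>
    (\<exists>c\<^sub>l>0. \<forall>i.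
       c\<^sub>w * (norm (w (Suc i) - w_star))\<^sup>2 + c\<^sub>l * (norm (lam (Suc i) - lam_b_star))\<^sup>2
       \<le> \<gamma> * (c\<^sub>w * (norm (w i - w_star))\<^sup>2 + c\<^sub>l * (norm (lam i - lam_b_star))\<^sup>2)) \<and>
    converges_linearly (\<lambda>i. (w i, lam i)) (w_star, lam_b_star)"
proof -
  let ?J = "augmented_cost J B b \<rho>"
  define \<sigma> \<tau> where "\<sigma> = sigma_max B" and "\<tau> = sigma_min_nonzero B"
  have smooth: "smooth \<delta>\<^sub>\<rho> ?J"
    using smooth_augmented_cost assms(2,4,6) by blast
  have convex: "convex_on UNIV ?J"
    using convex_augmented_cost assms(2,3) by blast
  have diff: "J differentiable (at x)" for x
    using assms(4) by (simp add: smooth_def)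
  have dual: "\<exists>!l. optimal_dual J B b w_star l \<and> l \<in> range ((*v) B)"
    using assms(5) unfolding unique_solution_def by (intro ex1_range_optimal_dual diff) blast
  have "optimal_dual J B b w_star lam_b_star \<and> lam_b_star \<in> range ((*v) B)"
    using theI'[OF dual] assms(15) by (simp add: range_optimal_dual_def)
  then have kkt: "grad J w_star + transpose B *v lam_b_star = 0" and feas: "B *v w_star = b"
    and lam_range: "lam_b_star \<in> range ((*v) B)"
    by (auto simp: optimal_dual_def)
  \<comment> \<open>Feasibility of \<open>w_star\<close> makes the penalty gradient vanish
    there.\<close>
  have gstar: "grad ?J w_star = - (transpose B *v lam_b_star)"
    using kkt by (simp add: grad_augmented_cost diff feas eq_neg_iff_add_eq_0)
  have "\<delta>\<^sub>\<rho> > 0"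
    using smooth by (simp add: smooth_def)
  then have \<mu>\<delta>: "\<mu>\<^sub>w * \<delta>\<^sub>\<rho> < 1"
    using assms(11) by (simp add: field_simps)
  have \<mu>\<nu>: "0 < \<mu>\<^sub>w * \<nu>\<^sub>\<rho>" "\<mu>\<^sub>w * \<nu>\<^sub>\<rho> \<le> \<mu>\<^sub>w * \<delta>\<^sub>\<rho>"
    using assms(8-10) by auto
  have \<tau>: "\<tau> > 0" and \<tau>_bound:
    "\<And>y. y \<in> range ((*v) B) \<Longrightarrow> \<tau>\<^sup>2 * (norm y)\<^sup>2 \<le> (norm (transpose B *v y))\<^sup>2"
    unfolding \<tau>_def using sigma_min_nonzero_bound[OF assms(1)] by auto
  have "\<sigma> \<noteq> 0"
    using norm_mult_le_sigma_max'[of B] assms(1) unfolding \<sigma>_def by (auto simp: matrix_eq)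
  then have "\<mu>\<^sub>l * \<sigma>\<^sup>2 \<le> \<nu>\<^sub>\<rho>"
    using assms(13) by (simp add: \<sigma>_def[symmetric] field_simps)
  then have "\<mu>\<^sub>w * (\<mu>\<^sub>l * \<sigma>\<^sup>2) \<le> \<mu>\<^sub>w * \<nu>\<^sub>\<rho>"
    using assms(10) by (intro mult_left_mono) auto
  \<comment> \<open>The dual step-size condition enters only through this bound, which serves both
    positivity of \<open>c\<^sub>w\<close> and the rate below.\<close>
  then have cw_ge: "c\<^sub>w \<ge> 1 - \<mu>\<^sub>w * \<nu>\<^sub>\<rho>"
    using assms(16) by (simp add: \<sigma>_def mult.assoc)
  then have cw: "c\<^sub>w > 0"
    using \<mu>\<nu> \<mu>\<delta> by linarith
  define \<gamma>\<^sub>1 where "\<gamma>\<^sub>1 = 1 - \<mu>\<^sub>w * \<nu>\<^sub>\<rho> * (1 - \<mu>\<^sub>w * \<delta>\<^sub>\<rho>)"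
  have \<gamma>: "\<gamma> = max \<gamma>\<^sub>1 (1 - \<mu>\<^sub>w * \<mu>\<^sub>l * \<tau>\<^sup>2)"
    using assms(17) by (simp add: \<gamma>\<^sub>1_def \<tau>_def)
  have "\<gamma>\<^sub>1 < 1"
    using \<mu>\<nu> \<mu>\<delta> by (simp add: \<gamma>\<^sub>1_def)
  moreover have "1 - \<mu>\<^sub>w * \<mu>\<^sub>l * \<tau>\<^sup>2 < 1"
    using \<tau> assms(10,12) by simp
  ultimately have \<gamma>_less: "\<gamma> < 1"
    using \<gamma> by simp
  have "\<mu>\<^sub>w * \<nu>\<^sub>\<rho> * (1 - \<mu>\<^sub>w * \<delta>\<^sub>\<rho>) \<le> 1 * 1"
    using \<mu>\<nu> \<mu>\<delta> by (intro mult_mono) auto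
  then have \<gamma>\<^sub>1_nonneg: "0 \<le> \<gamma>\<^sub>1"
    by (simp add: \<gamma>\<^sub>1_def)
  \<comment> \<open>With \<open>a = \<mu>\<^sub>w * \<nu>\<^sub>\<rho>\<close> and
    \<open>d = \<mu>\<^sub>w * \<delta>\<^sub>\<rho>\<close>, the gradient step contracts by
    \<open>1 - a * (2 - d)\<close>, which is at most \<open>(1 - a * (1 - d)) * (1 - a)\<close>. The
    second factor pays for the weight \<open>c\<^sub>w\<close>, so \<open>2 - d\<close> becomes
    \<open>1 - d\<close> in \<open>\<gamma>\<close>.\<close>
  have rate: "1 - \<mu>\<^sub>w * \<nu>\<^sub>\<rho> * (2 - \<mu>\<^sub>w * \<delta>\<^sub>\<rho>) \<le> \<gamma>\<^sub>1 * c\<^sub>w"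
  proof -
    have "1 - \<mu>\<^sub>w * \<nu>\<^sub>\<rho> * (2 - \<mu>\<^sub>w * \<delta>\<^sub>\<rho>) =
        \<gamma>\<^sub>1 * (1 - \<mu>\<^sub>w * \<nu>\<^sub>\<rho>) - (\<mu>\<^sub>w * \<nu>\<^sub>\<rho>)\<^sup>2 * (1 - \<mu>\<^sub>w * \<delta>\<^sub>\<rho>)"
      by (simp add: \<gamma>\<^sub>1_def algebra_simps power2_eq_square)
    also have "\<dots> \<le> \<gamma>\<^sub>1 * (1 - \<mu>\<^sub>w * \<nu>\<^sub>\<rho>)"
      using \<mu>\<delta> by simp
    also have "\<dots> \<le> \<gamma>\<^sub>1 * c\<^sub>w"
      using cw_ge \<gamma>\<^sub>1_nonneg by (rule mult_left_mono)
    finally show ?thesis .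
  qed
  have lam0: "lam 0 = 0"
    and w_step: "\<And>i. w (Suc i) = w i - \<mu>\<^sub>w *\<^sub>R (grad ?J (w i) + transpose B *v lam i)"
    and lam_step: "\<And>i. lam (Suc i) = lam i + \<mu>\<^sub>l *\<^sub>R (B *v w (Suc i) - b)"
    using assms(14) unfolding primal_dual_iterates_def by blast+
  have residual: "B *v w i - b = B *v (w i - w_star)" for i
    by (simp add: matrix_vector_mult_diff_distrib feas)
  \<comment> \<open>The zero start lies in the range, and every increment does because
    \<open>b = B *v w_star\<close>.\<close>
  have "lam i \<in> range ((*v) B)" for i
  proof (induction i)
    case 0
    show ?case
      using subspace_0[OF matrix_range_subspace] by (simp add: lam0)
  next
    case (Suc i)
    then show ?case
      unfolding lam_step residual
      by (intro subspace_add subspace_scale matrix_range_subspace) auto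
  qed
  then have err_range: "lam i - lam_b_star \<in> range ((*v) B)" for i
    using lam_range by (intro subspace_diff matrix_range_subspace)
  \<comment> \<open>The weight for which the cross terms cancel in
    \<open>primal_dual_energy\<close>.\<close>
  define c\<^sub>l where "c\<^sub>l = \<mu>\<^sub>w / \<mu>\<^sub>l"
  have cl: "c\<^sub>l > 0"
    using assms(10,12) by (simp add: c\<^sub>l_def)
  have step: "c\<^sub>w * (norm (w (Suc i) - w_star))\<^sup>2 + c\<^sub>l * (norm (lam (Suc i) - lam_b_star))\<^sup>2
       \<le> \<gamma> * (c\<^sub>w * (norm (w i - w_star))\<^sup>2 + c\<^sub>l * (norm (lam i - lam_b_star))\<^sup>2)" for i
  proof -
    define x y g where "x = w i - w_star" and "y = lam i - lam_b_star"
      and "g = grad ?J (w i) - grad ?J w_star"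
    \<comment> \<open>By \<open>gstar\<close>, subtracting the optimality condition turns gradient
      and dual variable into their errors; \<open>primal_dual_energy\<close> then applies with
      \<open>p = x - \<mu>\<^sub>w *\<^sub>R g\<close>.\<close>
    have "w (Suc i) - w_star = (x - \<mu>\<^sub>w *\<^sub>R g) - \<mu>\<^sub>w *\<^sub>R (transpose B *v y)"
      by (simp add: w_step x_def y_def g_def gstar matrix_vector_mult_diff_distrib algebra_simps)
    moreover have "lam (Suc i) - lam_b_star = y + \<mu>\<^sub>l *\<^sub>R (B *v (w (Suc i) - w_star))"
      unfolding lam_step residual by (simp add: y_def)
    ultimately have "c\<^sub>w * (norm (w (Suc i) - w_star))\<^sup>2 + c\<^sub>l * (norm (lam (Suc i) - lam_b_star))\<^sup>2
      \<le> (norm (x - \<mu>\<^sub>w *\<^sub>R g))\<^sup>2 + c\<^sub>l * ((norm y)\<^sup>2 - \<mu>\<^sub>w * \<mu>\<^sub>l * (norm (transpose B *v y))\<^sup>2)"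
      unfolding c\<^sub>l_def assms(16) by (rule primal_dual_energy[OF assms(10,12)])
    also have "\<dots> \<le> \<gamma> * (c\<^sub>w * (norm x)\<^sup>2) + c\<^sub>l * (\<gamma> * (norm y)\<^sup>2)"
    proof (rule add_mono)
      have "(norm (x - \<mu>\<^sub>w *\<^sub>R g))\<^sup>2 \<le> (1 - \<mu>\<^sub>w * \<nu>\<^sub>\<rho> * (2 - \<mu>\<^sub>w * \<delta>\<^sub>\<rho>)) * (norm x)\<^sup>2"
        using assms(7) smooth_convex_cocoercive[OF smooth convex] unfolding strongly_convex_wrt_def x_def g_def
        by (intro gradient_step_bound assms(10) \<mu>\<delta>) auto
      also have "\<dots> \<le> (\<gamma>\<^sub>1 * c\<^sub>w) * (norm x)\<^sup>2"
        using rate by (rule mult_right_mono) simp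
      also have "\<dots> \<le> (\<gamma> * c\<^sub>w) * (norm x)\<^sup>2"
        using \<gamma> cw by (intro mult_right_mono) auto
      finally show "(norm (x - \<mu>\<^sub>w *\<^sub>R g))\<^sup>2 \<le> \<gamma> * (c\<^sub>w * (norm x)\<^sup>2)"
        by (simp add: mult.assoc)
      have "\<mu>\<^sub>w * \<mu>\<^sub>l * (\<tau>\<^sup>2 * (norm y)\<^sup>2) \<le> \<mu>\<^sub>w * \<mu>\<^sub>l * (norm (transpose B *v y))\<^sup>2"
        using \<tau>_bound err_range assms(10,12) unfolding y_def by (intro mult_left_mono) auto
      then have "(norm y)\<^sup>2 - \<mu>\<^sub>w * \<mu>\<^sub>l * (norm (transpose B *v y))\<^sup>2
          \<le> (1 - \<mu>\<^sub>w * \<mu>\<^sub>l * \<tau>\<^sup>2) * (norm y)\<^sup>2"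
        by (simp add: algebra_simps)
      also have "\<dots> \<le> \<gamma> * (norm y)\<^sup>2"
        using \<gamma> by (intro mult_right_mono) auto
      finally show "c\<^sub>l * ((norm y)\<^sup>2 - \<mu>\<^sub>w * \<mu>\<^sub>l * (norm (transpose B *v y))\<^sup>2) \<le> c\<^sub>l * (\<gamma> * (norm y)\<^sup>2)"
        using cl by (intro mult_left_mono) auto
    qed
    finally show ?thesis
      by (simp add: x_def y_def algebra_simps)
  qed
  \<comment> \<open>Nonnegativity of \<open>\<gamma>\<close> comes from its first argument
    \<open>\<gamma>\<^sub>1\<close>.\<close>
  have "converges_linearly (\<lambda>i. (w i, lam i)) (w_star, lam_b_star)"
    using cw cl \<gamma>\<^sub>1_nonneg \<gamma>_less step \<gamma>
    by (intro converges_linearly_of_contraction[where a = "c\<^sub>w" and c = "c\<^sub>l" and q = \<gamma>]) auto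
  then show ?thesis
    using smooth dual cw \<gamma>_less cl step by blast
qed

end
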